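(* Let $\mathcal{G}$ be a finite connected graph and consider the Markov jump process on its vertices with rates $k(x,y)$, where $k(x,y)>0$ if $\{x,y\}$ is an edge of $\mathcal{G}$ and $k(x,y)=0$ otherwise. Let $\rho^s$ be its unique stationary probability distribution. For every edge $\{x,y\}$ of $\mathcal{G}$, the stationary traffic $T(x,y)=\rho^s(x)k(x,y)+\rho^s(y)k(y,x)$ satisfies $$T(x,y)=\frac{1}{W}\sum_{\ell_{xy}}\sum_{H_{\ell_{xy}}}W(H_{\ell_{xy}})\left(w(\ell_{xy}^{x\to y})+w(\ell_{xy}^{y\to x})\right),$$ where the first sum is over all loops $\ell_{xy}$ containing the edge $\{x,y\}$, including the trivial loop $x-y-x$ made of the two directions of that edge, and the second sum is over all collections of hairs $H_{\ell_{xy}}$ towards the loop $\ell_{xy}$.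
   Context: The stationary distribution is the probability distribution $\rho$ with $\sum_y [k(x,y)\rho(x)-k(y,x)\rho(y)]=0$ for all $x$. For a spanning tree $\mathcal{T}$ of $\mathcal{G}$, $\mathcal{T}_x$ is the in-tree to $x$, obtained by orienting every edge of $\mathcal{T}$ towards $x$. The normalization is $W=\sum_{x}\sum_{\mathcal{T}}\prod_{(z,z')\in\mathcal{T}_x}k(z,z')$, summed over all vertices $x$ and all spanning trees $\mathcal{T}$. The loops containing $\{x,y\}$ are: the simple (undirected) cycles of $\mathcal{G}$ of length at least $3$ containing the edge $\{x,y\}$, and the trivial loop $x-y-x$ with vertex set $\{x,y\}$. If $\ell$ is a simple cycle containing $\{x,y\}$, then $\ell^{x\to y}$ is $\ell$ oriented as a directed cycle traversing the edge from $x$ to $y$, $\ell^{y\to x}$ is the opposite orientation, and $w(\cdot)$ of a directed cycle is the product of the rates $k(z,z')$ over its directed edges. For the trivial loop, $w(\ell^{x\to y})=w(\ell^{y\to x})=k(x,y)k(y,x)$. A collection of hairs $H_\ell$ towards a loop $\ell$ is a set of directed edges of $\mathcal{G}$ forming a spanning forest oriented towards $\ell$: every vertex not on $\ell$ has exactly one outgoing edge in $H_\ell$, vertices on $\ell$ have none, and following the edges of $H_\ell$ from any vertex not on $\ell$ one reaches a vertex of $\ell$. Its weight is $W(H_\ell)=\prod_{(z,z')\in H_\ell}k(z,z')$, with $W(H_\ell)=1$ when $H_\ell$ is empty (no hairs). *)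

theory Defs
  imports "HOL-Probability.Probability_Mass_Function"
begin

section \<open>Graphs, cycles and spanning trees\<close>

text \<open>A simple graph is a vertex set \<open>V\<close> with a set \<open>E\<close> of two-element subsets of \<open>V\<close>.
  Graph_Theory's \<open>spanning_tree\<close> is not used: its \<open>forest\<close> excludes directed cycles only, and
  in a symmetric digraph every edge already is a directed cycle of length 2.\<close>

definition simple_graph :: "'a set \<Rightarrow> 'a set set \<Rightarrow> bool" where
  "simple_graph V E \<longleftrightarrow>
     finite V \<and> V \<noteq> {} \<and> (\<forall>e\<in>E. \<exists>u\<in>V. \<exists>v\<in>V. u \<noteq> v \<and> e = {u, v})"

definition arcs_of :: "'a set set \<Rightarrow> ('a \<times> 'a) set" where
  "arcs_of E = {(u, v). {u, v} \<in> E}"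

definition undirected :: "('a \<times> 'a) set \<Rightarrow> 'a set set" where
  "undirected D = (\<lambda>(u, v). {u, v}) ` D"

definition connected_graph :: "'a set \<Rightarrow> 'a set set \<Rightarrow> bool" where
  "connected_graph V E \<longleftrightarrow> (\<forall>u\<in>V. \<forall>v\<in>V. (u, v) \<in> (arcs_of E)\<^sup>*)"

definition cycle_arcs :: "'a list \<Rightarrow> ('a \<times> 'a) set" where
  "cycle_arcs vs = {(vs ! i, vs ! (Suc i mod length vs)) | i. i < length vs}"

text \<open>Cycles are identified with their arc sets (directed) or edge sets (undirected), so that
  neither a starting vertex nor, in the undirected case, a direction is distinguished.\<close>

definition directed_cycles :: "'a set set \<Rightarrow> ('a \<times> 'a) set set" where
  "directed_cycles E =
     {cycle_arcs vs | vs. distinct vs \<and> length vs \<ge> 3 \<and> cycle_arcs vs \<subseteq> arcs_of E}"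

definition simple_cycles :: "'a set set \<Rightarrow> 'a set set set" where
  "simple_cycles E = undirected ` directed_cycles E"

definition spanning_trees :: "'a set \<Rightarrow> 'a set set \<Rightarrow> 'a set set set" where
  "spanning_trees V E = {T. T \<subseteq> E \<and> connected_graph V T \<and> simple_cycles T = {}}"

text \<open>An edge \<open>{u, v}\<close> of the tree \<open>T\<close> is oriented from \<open>u\<close> to \<open>v\<close> if the simple path in
  \<open>T\<close> from \<open>u\<close> to \<open>x\<close> starts with it.\<close>

definition in_tree :: "'a set set \<Rightarrow> 'a \<Rightarrow> ('a \<times> 'a) set" where
  "in_tree T x = {(u, v). \<exists>p. distinct (u # v # p) \<and>
     successively (\<lambda>a b. {a, b} \<in> T) (u # v # p) \<and> last (u # v # p) = x}"

section \<open>Loops and hairs\<close>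

text \<open>Loops are represented by their edge sets, the trivial loop \<open>x - y - x\<close> by \<open>{{x, y}}\<close>;
  the vertex set of a loop \<open>L\<close> is \<open>\<Union>L\<close>.\<close>

definition loops_containing :: "'a set set \<Rightarrow> 'a \<Rightarrow> 'a \<Rightarrow> 'a set set set" where
  "loops_containing E x y = {L \<in> simple_cycles E. {x, y} \<in> L} \<union> {{{x, y}}}"

definition orient_cycle :: "'a set set \<Rightarrow> 'a \<Rightarrow> 'a \<Rightarrow> ('a \<times> 'a) set" where
  "orient_cycle L x y = (THE D. D \<in> directed_cycles L \<and> undirected D = L \<and> (x, y) \<in> D)"

definition hairs :: "'a set \<Rightarrow> 'a set set \<Rightarrow> 'a set set \<Rightarrow> ('a \<times> 'a) set set" where
  "hairs V E L = {H. H \<subseteq> arcs_of E \<and>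
     (\<forall>v\<in>V - \<Union>L. (\<exists>!u. (v, u) \<in> H) \<and> (\<exists>u\<in>\<Union>L. (v, u) \<in> H\<^sup>*)) \<and>
     (\<forall>v\<in>\<Union>L. \<forall>u. (v, u) \<notin> H)}"

section \<open>Weights\<close>

definition weight :: "('a \<Rightarrow> 'a \<Rightarrow> real) \<Rightarrow> ('a \<times> 'a) set \<Rightarrow> real" where
  "weight k D = (\<Prod>(z, z')\<in>D. k z z')"

definition loop_weight :: "('a \<Rightarrow> 'a \<Rightarrow> real) \<Rightarrow> 'a set set \<Rightarrow> 'a \<Rightarrow> 'a \<Rightarrow> real" where
  "loop_weight k L x y =
     (if L = {{x, y}} then k x y * k y x else weight k (orient_cycle L x y))"

definition normalization :: "'a set \<Rightarrow> 'a set set \<Rightarrow> ('a \<Rightarrow> 'a \<Rightarrow> real) \<Rightarrow> real" where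
  "normalization V E k = (\<Sum>x\<in>V. \<Sum>T\<in>spanning_trees V E. weight k (in_tree T x))"

section \<open>The Markov jump process\<close>

definition jump_rates :: "'a set \<Rightarrow> 'a set set \<Rightarrow> ('a \<Rightarrow> 'a \<Rightarrow> real) \<Rightarrow> bool" where
  "jump_rates V E k \<longleftrightarrow>
     (\<forall>x\<in>V. \<forall>y\<in>V. if {x, y} \<in> E then k x y > 0 else k x y = 0)"

definition is_stationary :: "'a set \<Rightarrow> ('a \<Rightarrow> 'a \<Rightarrow> real) \<Rightarrow> 'a pmf \<Rightarrow> bool" where
  "is_stationary V k \<rho> \<longleftrightarrow> set_pmf \<rho> \<subseteq> V \<and>
     (\<forall>x\<in>V. (\<Sum>y\<in>V. k x y * pmf \<rho> x - k y x * pmf \<rho> y) = 0)"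

definition stationary_distribution :: "'a set \<Rightarrow> ('a \<Rightarrow> 'a \<Rightarrow> real) \<Rightarrow> 'a pmf" where
  "stationary_distribution V k = (THE \<rho>. is_stationary V k \<rho>)"

definition traffic :: "'a set \<Rightarrow> ('a \<Rightarrow> 'a \<Rightarrow> real) \<Rightarrow> 'a \<Rightarrow> 'a \<Rightarrow> real" where
  "traffic V k x y =
     pmf (stationary_distribution V k) x * k x y + pmf (stationary_distribution V k) y * k y x"

end

theory Submission
  imports Defs
begin

text \<open>Orienting spanning trees identifies them with the spanning forests rooted at a single
  vertex. Adding an arc that leaves the root \<open>x\<close> to such a forest, or an arc into \<open>x\<close> to a forest
  rooted at its tail, gives in both cases each subgraph with one arc out of every vertex
  and its only directed cycle through \<open>x\<close> exactly once; hence the tree weights satisfy the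
  balance equations.
  A maximum principle for the ratio of two solutions shows that they determine the stationary
  distribution. Finally, a forest rooted at \<open>x\<close> splits uniquely into its path \<open>p\<close> from \<open>y\<close>
  to \<open>x\<close> and hairs towards the vertices of \<open>p\<close>, and adding the arc \<open>(x, y)\<close> closes \<open>p\<close> to a loop
  oriented from \<open>x\<close> to \<open>y\<close>, which is the trivial one if \<open>p = [y, x]\<close>.\<close>

section \<open>Paths and cycles\<close>

definition path_arcs :: "'a list \<Rightarrow> ('a \<times> 'a) set" where
  "path_arcs p = set (zip p (tl p))"

lemma path_arcs_simps [simp]:
  "path_arcs [] = {}"
  "path_arcs [a] = {}"
  "path_arcs (a # b # p) = insert (a, b) (path_arcs (b # p))"
  by (simp_all add: path_arcs_def)

lemma path_arcs_append:
  "p \<noteq> [] \<Longrightarrow> q \<noteq> [] \<Longrightarrow>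
     path_arcs (p @ q) = insert (last p, hd q) (path_arcs p \<union> path_arcs q)"
proof (induction p rule: induct_list012)
  case (2 a)
  then show ?case by (cases q) auto
qed auto

lemma path_arcs_Cons: "p \<noteq> [] \<Longrightarrow> path_arcs (a # p) = insert (a, hd p) (path_arcs p)"
  by (cases p) auto

lemma path_arcs_rev: "path_arcs (rev p) = (path_arcs p)\<inverse>"
proof (induction p rule: induct_list012)
  case (3 a b p)
  have "path_arcs (rev (a # b # p)) = insert (b, a) (path_arcs (rev (b # p)))"
    by (subst rev.simps(2), subst path_arcs_append) (auto simp: last_rev)
  with 3 show ?case by auto
qed auto

lemma path_arcs_subset: "path_arcs p \<subseteq> set p \<times> set p"
  by (induction p rule: induct_list012) auto

lemma successively_path_arcs:
  "successively (\<lambda>a b. (a, b) \<in> R) p \<longleftrightarrow> path_arcs p \<subseteq> R"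
  by (induction p rule: induct_list012) auto

lemma path_arcs_source:
  "p \<noteq> [] \<Longrightarrow> distinct p \<Longrightarrow> (a, b) \<in> path_arcs p \<Longrightarrow> a \<noteq> last p"
  by (induction p rule: induct_list012) (auto split: if_splits)

lemma path_arcs_functional:
  "distinct p \<Longrightarrow> (a, b) \<in> path_arcs p \<Longrightarrow> (a, c) \<in> path_arcs p \<Longrightarrow> b = c"
proof (induction p rule: induct_list012)
  case (3 u v p)
  then show ?case using path_arcs_subset[of "v # p"] by auto
qed auto

lemma path_arcs_step:
  "a \<in> set p \<Longrightarrow> a \<noteq> last p \<Longrightarrow> \<exists>b. (a, b) \<in> path_arcs p"
  by (induction p rule: induct_list012) (auto split: if_splits)

lemma path_arcs_rtrancl:
  "a \<in> set p \<Longrightarrow> (a, last p) \<in> (path_arcs p)\<^sup>*"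
proof (induction p arbitrary: a rule: induct_list012)
  case (3 u v p)
  have sub: "(path_arcs (v # p))\<^sup>* \<subseteq> (path_arcs (u # v # p))\<^sup>*"
    by (rule rtrancl_mono) auto
  have v: "(v, last (u # v # p)) \<in> (path_arcs (u # v # p))\<^sup>*"
    using 3(2)[of v] sub by auto
  show ?case
  proof (cases "a = u")
    case True
    then show ?thesis using v by (auto intro: converse_rtrancl_into_rtrancl)
  next
    case False
    then show ?thesis using 3(2)[of a] 3(3) sub by auto
  qed
qed auto

text \<open>Loop erasure: a new first vertex \<open>a\<close> that already occurs on the path
  replaces the whole initial segment before it.\<close>

lemma rtrancl_imp_path:
  assumes "(a, b) \<in> R\<^sup>*"
  obtains p where "distinct (a # p)" "path_arcs (a # p) \<subseteq> R" "last (a # p) = b"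
  using assms
proof (induction arbitrary: thesis rule: converse_rtrancl_induct)
  case base
  from base[of "[]"] show ?case by simp
next
  case (step a c)
  obtain p where p: "distinct (c # p)" "path_arcs (c # p) \<subseteq> R" "last (c # p) = b"
    using step.IH .
  show ?case
  proof (cases "a \<in> set (c # p)")
    case True
    then obtain xs ys where s: "c # p = xs @ a # ys" by (meson split_list)
    have "path_arcs (a # ys) \<subseteq> path_arcs (c # p)"
      unfolding s by (cases "xs = []") (auto simp: path_arcs_append)
    moreover have "distinct (a # ys)"
      using p(1) unfolding s by simp
    moreover have "last (a # ys) = b"
      using p(3) unfolding s by simp
    ultimately show ?thesis using p step.prems by blast
  next
    case False
    then show ?thesis using p step.hyps step.prems[of "c # p"] by auto
  qed
qed

text \<open>A functional relation leaves no choice of the next vertex, and distinctness makes both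
  lists stop at their only visit to the common last vertex.\<close>

lemma distinct_path_unique:
  assumes "\<And>a b c. (a, b) \<in> D \<Longrightarrow> (a, c) \<in> D \<Longrightarrow> b = c"
    and "distinct p" "distinct q" "p \<noteq> []" "q \<noteq> []" "hd p = hd q" "last p = last q"
    and "path_arcs p \<subseteq> D" "path_arcs q \<subseteq> D"
  shows "p = q"
  using assms(2-)
proof (induction p arbitrary: q rule: induct_list012)
  case (2 a)
  then obtain q' where "q = a # q'" by (cases q) auto
  with 2 show ?case by (cases "q' = []") auto
next
  case (3 a b p)
  obtain q' where q: "q = a # q'" using "3.prems"(4,5) by (cases q) simp_all
  have "q' \<noteq> []"
  proof
    assume "q' = []"
    then have "last (b # p) = a" using "3.prems"(6) q by simp
    then show False using "3.prems"(1) last_in_set[of "b # p"] by simp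
  qed
  then obtain c q'' where q': "q' = c # q''" by (cases q') auto
  have "b = c" using "3.prems"(7,8) q q' assms(1)[of a b c] by simp
  then have "b # p = c # q''" using "3.prems" q q' by (intro "3.IH"(2)) simp_all
  then show ?case using q q' by simp
qed auto

section \<open>Cycles as simple paths with a closing arc\<close>

lemma cycle_arcs_eq:
  assumes "p \<noteq> []"
  shows "cycle_arcs p = insert (last p, hd p) (path_arcs p)"
proof -
  have pa: "path_arcs p = {(p ! i, p ! Suc i) | i. Suc i < length p}"
    unfolding path_arcs_def set_zip by (auto simp: nth_tl)
  obtain n where n: "length p = Suc n" using assms by (cases p) auto
  have "cycle_arcs p = insert (p ! n, p ! 0) {(p ! i, p ! Suc i) | i. i < n}"
  proof -
    have "cycle_arcs p = (\<lambda>i. (p ! i, p ! (Suc i mod Suc n))) ` {..<Suc n}"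
      unfolding cycle_arcs_def n by auto
    also have "\<dots> = insert (p ! n, p ! 0) ((\<lambda>i. (p ! i, p ! (Suc i mod Suc n))) ` {..<n})"
      by (simp add: lessThan_Suc)
    also have "(\<lambda>i. (p ! i, p ! (Suc i mod Suc n))) ` {..<n} = (\<lambda>i. (p ! i, p ! Suc i)) ` {..<n}"
      by (intro image_cong) auto
    finally show ?thesis by auto
  qed
  then show ?thesis
    unfolding pa using assms n by (simp add: last_conv_nth hd_conv_nth)
qed

lemma cycle_arcs_rotate1: "cycle_arcs (rotate1 p) = cycle_arcs p"
proof (cases p)
  case (Cons a q)
  then show ?thesis
    by (cases "q = []") (auto simp: cycle_arcs_eq path_arcs_append path_arcs_Cons)
qed simp

lemma cycle_arcs_rotate: "cycle_arcs (rotate n p) = cycle_arcs p"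
  by (induction n) (simp_all add: cycle_arcs_rotate1)

lemma cycle_arcs_rev: "p \<noteq> [] \<Longrightarrow> cycle_arcs (rev p) = (cycle_arcs p)\<inverse>"
  by (auto simp: cycle_arcs_eq path_arcs_rev last_rev hd_rev)

text \<open>If \<open>a\<close> stands at position \<open>i\<close>, rotating by
  \<open>Suc i\<close> brings \<open>b\<close> to the front and \<open>a\<close> to the end. The
  cycle is then a simple path from \<open>b\<close> to \<open>a\<close> closed by the given
  arc.\<close>

lemma cycle_rotate_to:
  assumes "(a, b) \<in> cycle_arcs p" "distinct p"
  obtains q where "distinct q" "length q = length p" "cycle_arcs q = cycle_arcs p"
    "q \<noteq> []" "hd q = b" "last q = a"
proof -
  obtain i where i: "i < length p" "a = p ! i" "b = p ! (Suc i mod length p)"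
    using assms(1) by (auto simp: cycle_arcs_def)
  have ne: "p \<noteq> []" using i by auto
  define q where "q = rotate (Suc i) p"
  have "hd q = b"
    unfolding q_def using i ne by (simp add: hd_rotate_conv_nth del: rotate_Suc)
  moreover have "last q = a"
    using i ne by (simp add: q_def last_conv_nth nth_rotate del: rotate_Suc)
  ultimately show ?thesis
    using that[of q] assms ne by (simp add: q_def cycle_arcs_rotate del: rotate_Suc)
qed

section \<open>Edge sets of paths and cycles\<close>

lemma undirected_insert [simp]: "undirected (insert (a, b) D) = insert {a, b} (undirected D)"
  and undirected_empty [simp]: "undirected {} = {}"
  by (auto simp: undirected_def)

lemma undirected_converse: "undirected (D\<inverse>) = undirected D"
  by (force simp: undirected_def insert_commute)

lemma in_undirected_iff: "{a, b} \<in> undirected D \<longleftrightarrow> (a, b) \<in> D \<or> (b, a) \<in> D"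
  by (force simp: undirected_def doubleton_eq_iff)

lemma undirected_subset_iff: "undirected D \<subseteq> E \<longleftrightarrow> D \<subseteq> arcs_of E"
  by (auto simp: undirected_def arcs_of_def)

lemma Union_undirected_path_subset: "\<Union>(undirected (path_arcs p)) \<subseteq> set p"
  using path_arcs_subset[of p] by (auto simp: undirected_def)

lemma Union_undirected_cycle:
  "p \<noteq> [] \<Longrightarrow> \<Union>(undirected (cycle_arcs p)) = set p"
proof (induction p rule: induct_list012)
  case (3 a b p)
  then show ?case by (auto simp: cycle_arcs_eq)
qed (auto simp: cycle_arcs_eq)

text \<open>The first vertex of a simple path lies on its first edge only. The edge set thus reveals
  the second vertex, and removing this edge leaves the same situation for the tails.\<close>

lemma undirected_path_inj:
  assumes "distinct p" "distinct q" "p \<noteq> []" "q \<noteq> []" "hd p = hd q"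
    and "undirected (path_arcs p) = undirected (path_arcs q)"
  shows "p = q"
  using assms
proof (induction p arbitrary: q rule: induct_list012)
  case (2 a)
  then obtain q' where q: "q = a # q'" by (cases q) auto
  then have "undirected (path_arcs (a # q')) = {}" using 2 by simp
  then show ?case using q by (cases q') auto
next
  case (3 a b p)
  then obtain q' where q: "q = a # q'" by (cases q) auto
  with 3 obtain c q'' where q': "q' = c # q''" by (cases q') auto
  have eq: "insert {a, b} (undirected (path_arcs (b # p))) =
            insert {a, c} (undirected (path_arcs (c # q'')))"
    using 3 q q' by simp
  have np: "{a, v} \<notin> undirected (path_arcs (b # p))" for v
    using Union_undirected_path_subset[of "b # p"] 3 by auto
  have nq: "{a, v} \<notin> undirected (path_arcs (c # q''))" for v
    using Union_undirected_path_subset[of "c # q''"] 3 q q' by auto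
  have "{a, b} = {a, c}" using eq nq by blast
  then have bc: "b = c" by (auto simp: doubleton_eq_iff)
  have "undirected (path_arcs (b # p)) = undirected (path_arcs (c # q''))"
    using eq np[of b] nq[of c] unfolding bc by (simp add: insert_ident)
  moreover have "distinct (b # p)" "distinct (c # q'')" using 3 q q' by auto
  ultimately have "b # p = c # q''" using "3.IH"(2)[of "c # q''"] bc by simp
  then show ?case using q q' by simp
qed auto

text \<open>With at least three vertices the closing edge is not an edge of the path, so removing it
  from both edge sets reduces the claim to paths. Shorter lists are determined by their ends and
  their length, and the length is that of the common vertex set.\<close>

lemma undirected_cycle_inj:
  assumes "distinct p" "distinct q" "p \<noteq> []" "q \<noteq> []" "hd p = hd q" "last p = last q"
    and "undirected (cycle_arcs p) = undirected (cycle_arcs q)"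
  shows "p = q"
proof -
  have short: "r = [hd r] \<or> r = [hd r, last r]" if "r \<noteq> []" "length r \<le> 2" for r :: "'a list"
  proof (cases r)
    case (Cons a s)
    then show ?thesis using that by (cases s) auto
  qed (use that in simp)
  have key: "r = [hd r] \<or> r = [hd r, last r] \<or>
      {last r, hd r} \<notin> undirected (path_arcs r)" if "distinct r" "r \<noteq> []" for r :: "'a list"
  proof (cases "length r \<le> 2")
    case True
    then show ?thesis using short that(2) by blast
  next
    case False
    then obtain a b s where r: "r = a # b # s" "s \<noteq> []"
      by (cases r; cases "tl r"; auto)
    have "a \<notin> \<Union>(undirected (path_arcs (b # s)))"
      using Union_undirected_path_subset[of "b # s"] that r by auto
    then have "{last r, hd r} \<notin> undirected (path_arcs (b # s))" using r by auto
    moreover have "{last r, hd r} \<noteq> {a, b}"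
      using that r by (auto simp: doubleton_eq_iff)
    ultimately show ?thesis using r by auto
  qed
  have edges: "undirected (cycle_arcs r) = insert {last r, hd r} (undirected (path_arcs r))"
    if "r \<noteq> []" for r :: "'a list" using that by (simp add: cycle_arcs_eq)
  have V: "set p = set q"
    using Union_undirected_cycle[of p] Union_undirected_cycle[of q] assms by simp
  then have len: "length p = length q"
    using assms(1,2) distinct_card by metis
  show ?thesis
  proof (cases "length p \<le> 2")
    case True
    then have "p = [hd p] \<or> p = [hd p, last p]" "q = [hd q] \<or> q = [hd q, last q]"
      using short assms len by metis+
    then show ?thesis using assms len by (metis length_Cons list.size(3) n_not_Suc_n)
  next
    case False
    then have "p \<noteq> [hd p]" "p \<noteq> [hd p, last p]" "q \<noteq> [hd q]" "q \<noteq> [hd q, last q]"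
      using len by (metis length_Cons list.size(3) One_nat_def Suc_1 le_refl one_le_numeral)+
    then have "undirected (path_arcs p) = undirected (path_arcs q)"
      using key[of p] key[of q] edges[of p] edges[of q] assms by (metis insert_ident)
    then show ?thesis using undirected_path_inj assms by blast
  qed
qed

lemma sym_arcs_of: "sym (arcs_of E)"
  by (auto simp: sym_def arcs_of_def insert_commute)

text \<open>If the paths part after \<open>a\<close>, going along the first one until it meets the
  second and returning along the second closes a cycle. So they share the next vertex, and the
  induction continues with the tails.\<close>

lemma acyclic_path_unique:
  assumes "simple_cycles T = {}"
    and "distinct p" "distinct q" "p \<noteq> []" "q \<noteq> []" "hd p = hd q" "last p = last q"
    and "path_arcs p \<subseteq> arcs_of T" "path_arcs q \<subseteq> arcs_of T"
  shows "p = q"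
  using assms(2-)
proof (induction p arbitrary: q rule: induct_list012)
  case (2 a)
  then obtain q' where "q = a # q'" by (cases q) auto
  with 2 show ?case by (cases "q' = []") auto
next
  case (3 a b p)
  define p' where "p' = b # p"
  obtain q' where q: "q = a # q'" using "3.prems"(4,5) by (cases q) simp_all
  have dp: "distinct (a # p')" "path_arcs (a # p') \<subseteq> arcs_of T" "p' \<noteq> []"
    using "3.prems" by (auto simp: p'_def)
  have dq: "distinct (a # q')" "path_arcs (a # q') \<subseteq> arcs_of T"
    using "3.prems" q by auto
  have last: "last (a # p') = last (a # q')" using "3.prems"(6) q by (simp add: p'_def)
  have "q' \<noteq> []"
  proof
    assume "q' = []"
    then have "last p' = a" using last dp by simp
    then show False using dp last_in_set[of p'] by auto
  qed
  then have "last p' \<in> set q'" using last dp by (metis last.simps last_in_set)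
  \<comment> \<open>Taking the first vertex of \<open>p'\<close> that lies on \<open>q'\<close>
    keeps \<open>ps\<close> disjoint from \<open>q'\<close>, which makes the list \<open>c\<close>
    below distinct.\<close>
  then obtain ps z ps' where p': "p' = ps @ z # ps'" "z \<in> set q'" "\<forall>w\<in>set ps. w \<notin> set q'"
    using split_list_first_prop[of p' "\<lambda>w. w \<in> set q'"] dp(3) last_in_set by metis
  then obtain qs qs' where q': "q' = qs @ z # qs'" by (meson split_list)
  define c where "c = a # ps @ z # rev qs"
  have "ps = [] \<and> qs = []"
  proof (rule ccontr)
    assume ne: "\<not> (ps = [] \<and> qs = [])"
    have "distinct c"
      using dp(1) dq(1) p' q' by (auto simp: c_def)
    moreover have "length c \<ge> 3" using ne by (cases ps; cases qs) (auto simp: c_def)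
    moreover have "cycle_arcs c \<subseteq> arcs_of T"
    proof -
      have P: "path_arcs (a # ps @ [z]) \<subseteq> arcs_of T"
        using dp(2) path_arcs_append[of "a # ps @ [z]" ps'] p' by (cases "ps' = []") auto
      have "path_arcs (a # qs @ [z]) \<subseteq> arcs_of T"
        using dq(2) path_arcs_append[of "a # qs @ [z]" qs'] q' by (cases "qs' = []") auto
      then have Q: "path_arcs (rev (a # qs @ [z])) \<subseteq> arcs_of T"
        using sym_arcs_of[of T] unfolding path_arcs_rev sym_conv_converse_eq by auto
      have "cycle_arcs c = path_arcs (a # ps @ [z]) \<union> path_arcs (rev (a # qs @ [z]))"
      proof -
        have "path_arcs c = path_arcs (a # ps @ [z]) \<union> path_arcs (z # rev qs)"
          using path_arcs_append[of "a # ps" "z # rev qs"] path_arcs_append[of "a # ps" "[z]"]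
          by (auto simp: c_def)
        moreover have "path_arcs (rev (a # qs @ [z])) =
            insert (last (z # rev qs), a) (path_arcs (z # rev qs))"
          using path_arcs_append[of "z # rev qs" "[a]"] by simp
        ultimately show ?thesis by (simp add: cycle_arcs_eq c_def)
      qed
      then show ?thesis using P Q by simp
    qed
    ultimately have "undirected (cycle_arcs c) \<in> simple_cycles T"
      unfolding simple_cycles_def directed_cycles_def by blast
    then show False using assms(1) by simp
  qed
  then have "hd p' = hd q'" using p' q' by simp
  then have "p' = q'"
    using dp dq last \<open>q' \<noteq> []\<close> unfolding p'_def
    by (intro "3.IH"(2)) (simp_all add: path_arcs_Cons)
  then show ?case using q by (simp add: p'_def)
qed auto

lemma in_tree_alt:
  "(u, v) \<in> in_tree T r \<longleftrightarrow>
     (\<exists>p. distinct (u # v # p) \<and> path_arcs (u # v # p) \<subseteq> arcs_of T \<and> last (u # v # p) = r)"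
proof -
  have "successively (\<lambda>a b. {a, b} \<in> T) p \<longleftrightarrow> path_arcs p \<subseteq> arcs_of T" for p
    using successively_path_arcs[of "arcs_of T" p] by (simp add: arcs_of_def)
  then show ?thesis unfolding in_tree_def by simp
qed

section \<open>Forests rooted in a set\<close>

text \<open>The condition in \<open>hairs\<close> with an arbitrary root set \<open>R\<close>. Hairs
  towards a loop and spanning trees oriented towards a vertex (\<open>R = {r}\<close>) become
  instances of one notion.\<close>

definition forests :: "'a set \<Rightarrow> 'a set set \<Rightarrow> 'a set \<Rightarrow> ('a \<times> 'a) set set" where
  "forests V E R = {H. H \<subseteq> arcs_of E \<and>
     (\<forall>v\<in>V - R. (\<exists>!u. (v, u) \<in> H) \<and> (\<exists>u\<in>R. (v, u) \<in> H\<^sup>*)) \<and>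
     (\<forall>v\<in>R. \<forall>u. (v, u) \<notin> H)}"

lemma hairs_eq_forests: "hairs V E L = forests V E (\<Union>L)"
  by (simp add: hairs_def forests_def)

lemma arcs_of_undirected: "arcs_of (undirected D) = D \<union> D\<inverse>"
  by (auto simp: arcs_of_def in_undirected_iff)

lemma arcs_of_mono: "T \<subseteq> E \<Longrightarrow> arcs_of T \<subseteq> arcs_of E"
  by (auto simp: arcs_of_def)

lemma simple_graph_arcD:
  assumes "simple_graph V E" "(u, v) \<in> arcs_of E"
  shows "u \<in> V" "v \<in> V" "u \<noteq> v"
  using assms by (auto simp: simple_graph_def arcs_of_def doubleton_eq_iff)

lemma simple_graph_arcs_subset: "simple_graph V E \<Longrightarrow> arcs_of E \<subseteq> V \<times> V"
  by (auto dest: simple_graph_arcD)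

lemma finite_arcs_of: "simple_graph V E \<Longrightarrow> finite (arcs_of E)"
  by (rule finite_subset[OF simple_graph_arcs_subset]) (auto simp: simple_graph_def)

lemma forests_arcs: "D \<in> forests V E R \<Longrightarrow> D \<subseteq> arcs_of E"
  by (simp add: forests_def)

lemma finite_forests: "simple_graph V E \<Longrightarrow> finite (forests V E R)"
  by (rule finite_subset[of _ "Pow (arcs_of E)"]) (auto simp: finite_arcs_of forests_def)

lemma forests_finite_arcs: "simple_graph V E \<Longrightarrow> D \<in> forests V E R \<Longrightarrow> finite D"
  by (rule finite_subset[OF forests_arcs finite_arcs_of])

lemma forests_reach:
  assumes "D \<in> forests V E {r}" "v \<in> V"
  shows "(v, r) \<in> D\<^sup>*"
  using assms by (cases "v = r") (auto simp: forests_def)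

section \<open>Functionality, acyclicity and existence of rooted forests\<close>

context
  fixes V :: "'a set" and E :: "'a set set"
  assumes graph: "simple_graph V E"
begin

lemma forests_functional:
  assumes "D \<in> forests V E R" "(a, b) \<in> D" "(a, c) \<in> D"
  shows "b = c"
proof -
  have "a \<in> V - R"
    using assms simple_graph_arcD[OF graph] by (auto simp: forests_def)
  then show ?thesis using assms by (auto simp: forests_def)
qed

text \<open>The rank \<open>d\<close> is the number of steps to \<open>R\<close>; it drops along
  every arc because the outgoing arc is unique.\<close>

lemma forests_rank:
  assumes "D \<in> forests V E R"
  obtains d :: "'a \<Rightarrow> nat" where "\<And>u v. (u, v) \<in> D \<Longrightarrow> d v < d u"
proof
  define d where "d v = (LEAST n. \<exists>r\<in>R. (v, r) \<in> D ^^ n)" for v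
  fix u v assume uv: "(u, v) \<in> D"
  then have "u \<in> V - R"
    using assms simple_graph_arcD[OF graph] by (auto simp: forests_def)
  then have "\<exists>r\<in>R. (u, r) \<in> D\<^sup>*" using assms by (simp add: forests_def)
  then have "\<exists>n. \<exists>r\<in>R. (u, r) \<in> D ^^ n" unfolding rtrancl_is_UN_relpow by blast
  from LeastI_ex[OF this] obtain r where r: "r \<in> R" "(u, r) \<in> D ^^ d u"
    unfolding d_def by blast
  have "d u \<noteq> 0" using r \<open>u \<in> V - R\<close> by (metis DiffD2 relpow_0_E)
  then obtain m where m: "d u = Suc m" by (metis not0_implies_Suc)
  then obtain w where "(u, w) \<in> D" "(w, r) \<in> D ^^ m"
    using r(2) relpow_Suc_E2 by metis
  \<comment> \<open>Functionality forces \<open>w = v\<close>: the shortest walk from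
    \<open>u\<close> to \<open>R\<close> starts with the given arc.\<close>
  then have "(v, r) \<in> D ^^ m" using forests_functional assms uv by metis
  then have "d v \<le> m" unfolding d_def using r(1) by (intro Least_le) blast
  then show "d v < d u" using m by simp
qed

lemma forests_acyclic:
  assumes "D \<in> forests V E R"
  shows "acyclic D"
proof -
  obtain d :: "'a \<Rightarrow> nat" where d: "\<And>u v. (u, v) \<in> D \<Longrightarrow> d v < d u"
    using forests_rank[OF assms] by blast
  have "d v < d u" if "(u, v) \<in> D\<^sup>+" for u v
    using that by induction (use d in fastforce)+
  then show ?thesis unfolding acyclic_def by blast
qed

text \<open>With \<open>d\<close> the graph distance to \<open>r\<close>, each other vertex
  \<open>v\<close> gets a single arc to a neighbour \<open>f v\<close> at smaller distance. These
  arcs lead to \<open>r\<close> by induction on the distance.\<close>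

lemma forests_nonempty:
  assumes "connected_graph V E" "r \<in> V"
  shows "forests V E {r} \<noteq> {}"
proof -
  define A where "A = arcs_of E"
  define d where "d v = (LEAST n. (v, r) \<in> A ^^ n)" for v
  have ex: "\<exists>u. (v, u) \<in> A \<and> d u < d v" if v: "v \<in> V" "v \<noteq> r" for v
  proof -
    have "\<exists>n. (v, r) \<in> A ^^ n"
      using assms v unfolding connected_graph_def A_def by (simp add: rtrancl_is_UN_relpow)
    from LeastI_ex[OF this] have r: "(v, r) \<in> A ^^ d v" unfolding d_def .
    have "d v \<noteq> 0" using r v by (metis relpow_0_E)
    then obtain m where m: "d v = Suc m" by (metis not0_implies_Suc)
    then obtain w where w: "(v, w) \<in> A" "(w, r) \<in> A ^^ m" using r relpow_Suc_E2 by metis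
    then have "d w \<le> m" unfolding d_def by (intro Least_le)
    then show ?thesis using m w by auto
  qed
  then obtain f where f: "\<And>v. v \<in> V \<Longrightarrow> v \<noteq> r \<Longrightarrow> (v, f v) \<in> A \<and> d (f v) < d v" by metis
  define D where "D = {(v, f v) | v. v \<in> V - {r}}"
  have reach: "(v, r) \<in> D\<^sup>*" if "v \<in> V" for v
    using that
  proof (induction "d v" arbitrary: v rule: less_induct)
    case less
    show ?case
    proof (cases "v = r")
      case False
      then have "(v, f v) \<in> D" "f v \<in> V" "d (f v) < d v"
        using f[of v] less.prems simple_graph_arcD(2)[OF graph] by (auto simp: D_def A_def)
      then show ?thesis using less.hyps by (meson converse_rtrancl_into_rtrancl)
    qed simp
  qed
  have "D \<in> forests V E {r}"
    unfolding forests_def using f reach by (auto simp: D_def A_def)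
  then show ?thesis by blast
qed

section \<open>Spanning trees and their orientations\<close>

lemma tree_edges_in_V:
  assumes "T \<in> spanning_trees V E" "(u, v) \<in> arcs_of T"
  shows "u \<in> V" "v \<in> V" "u \<noteq> v"
proof -
  have "(u, v) \<in> arcs_of E" using assms arcs_of_mono[of T E] by (auto simp: spanning_trees_def)
  then show "u \<in> V" "v \<in> V" "u \<noteq> v" using simple_graph_arcD[OF graph] by blast+
qed

text \<open>Connectedness provides a simple path from each vertex to \<open>r\<close>, and by
  \<open>acyclic_path_unique\<close> it is the only one, so exactly one arc leaves each vertex other
  than \<open>r\<close>.\<close>

lemma in_tree_forest:
  assumes T: "T \<in> spanning_trees V E" and r: "r \<in> V"
  shows "in_tree T r \<in> forests V E {r}"
proof -
  have sub: "in_tree T r \<subseteq> arcs_of T" by (auto simp: in_tree_alt)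
  \<comment> \<open>Every suffix of a simple path to \<open>r\<close> is again one, so all arcs of
    the path are tree arcs oriented towards \<open>r\<close>; this shows that \<open>r\<close> can
    be reached inside \<open>in_tree T r\<close>.\<close>
  have suffix: "path_arcs p \<subseteq> in_tree T r"
    if "distinct p" "path_arcs p \<subseteq> arcs_of T" "p \<noteq> []" "last p = r" for p
    using that
  proof (induction p rule: induct_list012)
    case (3 a b p)
    have "(a, b) \<in> in_tree T r" using "3.prems" unfolding in_tree_alt by blast
    moreover have "path_arcs (b # p) \<subseteq> in_tree T r"
      using "3.prems" by (intro "3.IH"(2)) simp_all
    ultimately show ?case by simp
  qed simp_all
  have "(\<exists>!u. (v, u) \<in> in_tree T r) \<and> (v, r) \<in> (in_tree T r)\<^sup>*" if v: "v \<in> V" "v \<noteq> r" for v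
  proof -
    have "(v, r) \<in> (arcs_of T)\<^sup>*"
      using T v r by (auto simp: spanning_trees_def connected_graph_def)
    then obtain p where p: "distinct (v # p)" "path_arcs (v # p) \<subseteq> arcs_of T" "last (v # p) = r"
      by (rule rtrancl_imp_path)
    then obtain u p' where p': "p = u # p'" using v by (cases p) auto
    have "(v, u) \<in> in_tree T r" using p p' unfolding in_tree_alt by blast
    moreover have "w = u" if w: "(v, w) \<in> in_tree T r" for w
    proof -
      obtain q where "distinct (v # w # q)" "path_arcs (v # w # q) \<subseteq> arcs_of T"
        "last (v # w # q) = r" using w unfolding in_tree_alt by blast
      then have "v # w # q = v # p"
        using p T by (intro acyclic_path_unique[of T]) (simp_all add: spanning_trees_def)
      then show ?thesis using p' by simp
    qed
    moreover have "(v, r) \<in> (in_tree T r)\<^sup>*"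
      using path_arcs_rtrancl[of v "v # p"] suffix[of "v # p"] p
      by (metis list.distinct(1) list.set_intros(1) rtrancl_mono subsetD)
    ultimately show ?thesis by blast
  qed
  moreover have "(r, u) \<notin> in_tree T r" for u
    unfolding in_tree_alt by (metis distinct.simps(2) last_ConsR last_in_set list.distinct(1))
  moreover have "in_tree T r \<subseteq> arcs_of E"
    using sub arcs_of_mono[of T E] T by (auto simp: spanning_trees_def)
  ultimately show ?thesis by (auto simp: forests_def)
qed

text \<open>To orient an edge \<open>{u, v}\<close>, take a simple path from \<open>u\<close> to
  \<open>r\<close>. If it visits \<open>v\<close>, jumping from \<open>u\<close> directly to
  \<open>v\<close> gives a path that starts with \<open>(u, v)\<close>; otherwise prepending
  \<open>v\<close> gives one that starts with \<open>(v, u)\<close>.\<close>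

lemma undirected_in_tree:
  assumes T: "T \<in> spanning_trees V E" and r: "r \<in> V"
  shows "undirected (in_tree T r) = T"
proof
  show "undirected (in_tree T r) \<subseteq> T"
    unfolding undirected_subset_iff by (auto simp: in_tree_alt)
  show "T \<subseteq> undirected (in_tree T r)"
  proof
    fix e assume e: "e \<in> T"
    then have "e \<in> E" using T by (auto simp: spanning_trees_def)
    then obtain u v where uv: "e = {u, v}" using graph unfolding simple_graph_def by blast
    then have arc: "(u, v) \<in> arcs_of T" "(v, u) \<in> arcs_of T"
      using e by (auto simp: arcs_of_def insert_commute)
    have ne: "u \<noteq> v" "u \<in> V" using tree_edges_in_V T arc by blast+
    have "(u, r) \<in> (arcs_of T)\<^sup>*"
      using T ne r by (auto simp: spanning_trees_def connected_graph_def)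
    then obtain p where p: "distinct (u # p)" "path_arcs (u # p) \<subseteq> arcs_of T" "last (u # p) = r"
      by (rule rtrancl_imp_path)
    show "e \<in> undirected (in_tree T r)"
    proof (cases "v \<in> set p")
      case True
      then obtain xs ys where s: "p = xs @ v # ys" by (meson split_list)
      have "path_arcs (v # ys) \<subseteq> path_arcs (u # p)"
        unfolding s using path_arcs_append[of "u # xs" "v # ys"] by auto
      then have "path_arcs (u # v # ys) \<subseteq> arcs_of T" using p arc by simp
      moreover have "distinct (u # v # ys)" "last (u # v # ys) = r"
        using p(1,3) unfolding s by simp_all
      ultimately have "(u, v) \<in> in_tree T r" unfolding in_tree_alt by blast
      then show ?thesis unfolding uv in_undirected_iff ..
    next
      case False
      then have "distinct (v # u # p)" "path_arcs (v # u # p) \<subseteq> arcs_of T" "last (v # u # p) = r"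
        using p arc ne by simp_all
      then have "(v, u) \<in> in_tree T r" unfolding in_tree_alt by blast
      then show ?thesis unfolding uv in_undirected_iff ..
    qed
  qed
qed

text \<open>At a vertex of maximal rank on an undirected cycle, both cycle edges would have to be
  arcs of \<open>D\<close> leaving it, but at most one arc does.\<close>

lemma forest_no_cycle:
  assumes D: "D \<in> forests V E R"
  shows "simple_cycles (undirected D) = {}"
proof (rule ccontr)
  assume "simple_cycles (undirected D) \<noteq> {}"
  then obtain vs where vs: "distinct vs" "length vs \<ge> 3" "cycle_arcs vs \<subseteq> D \<union> D\<inverse>"
    by (auto simp: simple_cycles_def directed_cycles_def arcs_of_undirected)
  obtain d :: "'a \<Rightarrow> nat" where d: "\<And>u v. (u, v) \<in> D \<Longrightarrow> d v < d u"
    using forests_rank[OF D] by blast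
  have "vs \<noteq> []" using vs by auto
  then obtain m where m: "m \<in> set vs" "\<And>v. v \<in> set vs \<Longrightarrow> d v \<le> d m"
    using Max_in[of "d ` set vs"] Max_ge[of "d ` set vs"] by (metis (no_types, lifting)
      finite_imageI finite_set image_iff image_is_empty set_empty)
  obtain i where i: "i < length vs" "vs ! i = m" using m(1) by (auto simp: in_set_conv_nth)
  \<comment> \<open>The rotation starts the cycle at the maximal vertex \<open>m\<close>; its two
    neighbours are then the second and the last entry, distinct because the length is at least
    3.\<close>
  define ws where "ws = rotate i vs"
  have ws: "distinct ws" "length ws \<ge> 3" "cycle_arcs ws \<subseteq> D \<union> D\<inverse>" "set ws = set vs"
    using vs by (simp_all add: ws_def cycle_arcs_rotate)
  have "hd ws = m" using i \<open>vs \<noteq> []\<close> by (simp add: ws_def hd_rotate_conv_nth)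
  then obtain a b s where s: "ws = m # a # b # s"
    using ws(2) by (cases ws; cases "tl ws"; cases "tl (tl ws)") auto
  define l where "l = last (b # s)"
  have "l \<in> set (b # s)" unfolding l_def by (rule last_in_set) simp
  then have "l \<noteq> a" "l \<in> set vs" "a \<in> set vs" using ws s by auto
  have "(m, a) \<in> D \<union> D\<inverse>" "(l, m) \<in> D \<union> D\<inverse>"
    using ws(3) s by (auto simp: cycle_arcs_eq l_def)
  moreover have "(a, m) \<notin> D" "(l, m) \<notin> D"
    using d m(2) \<open>l \<in> set vs\<close> \<open>a \<in> set vs\<close> by (meson leD)+
  ultimately have "(m, a) \<in> D" "(m, l) \<in> D" by auto
  then show False using forests_functional[OF D] \<open>l \<noteq> a\<close> by blast
qed

lemma undirected_forest_spanning_tree: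
  assumes D: "D \<in> forests V E {r}"
  shows "undirected D \<in> spanning_trees V E"
proof -
  have "(u, v) \<in> (D \<union> D\<inverse>)\<^sup>*" if "u \<in> V" "v \<in> V" for u v
  proof -
    have "(u, r) \<in> (D \<union> D\<inverse>)\<^sup>*" "(v, r) \<in> (D \<union> D\<inverse>)\<^sup>*"
      using forests_reach[OF D] that by (meson in_rtrancl_UnI)+
    moreover have "sym ((D \<union> D\<inverse>)\<^sup>*)" by (intro sym_rtrancl) (auto simp: sym_def)
    ultimately show ?thesis by (meson rtrancl_trans symD)
  qed
  then show ?thesis
    using forest_no_cycle[OF D] forests_arcs[OF D]
    by (simp add: spanning_trees_def connected_graph_def arcs_of_undirected undirected_subset_iff)
qed

text \<open>An arc \<open>(v, u)\<close> of \<open>D\<close> followed by the path in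
  \<open>D\<close> from \<open>u\<close> to \<open>r\<close> is simple, as a return to
  \<open>v\<close> would close a directed cycle. This gives one inclusion; equality follows since
  both sides have exactly one arc out of each vertex other than \<open>r\<close>.\<close>

lemma in_tree_undirected:
  assumes D: "D \<in> forests V E {r}" and r: "r \<in> V"
  shows "in_tree (undirected D) r = D"
proof -
  have F: "in_tree (undirected D) r \<in> forests V E {r}"
    using in_tree_forest undirected_forest_spanning_tree D r by blast
  have sub: "D \<subseteq> in_tree (undirected D) r"
  proof (rule subrelI)
    fix v u assume vu: "(v, u) \<in> D"
    then have "u \<in> V" using forests_arcs[OF D] simple_graph_arcD[OF graph] by blast
    then obtain p where p: "distinct (u # p)" "path_arcs (u # p) \<subseteq> D" "last (u # p) = r"
      using rtrancl_imp_path[OF forests_reach[OF D]] by metis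
    have "v \<notin> set (u # p)"
    proof
      assume "v \<in> set (u # p)"
      then obtain xs ys where s: "u # p = xs @ v # ys" by (meson split_list)
      have "(u, v) \<in> D\<^sup>*"
      proof -
        have "path_arcs (xs @ [v]) \<subseteq> D"
          using p(2) path_arcs_append[of "xs @ [v]" ys] unfolding s by (cases "ys = []") auto
        moreover have "u \<in> set (xs @ [v])" using s by (cases xs) auto
        ultimately show ?thesis
          using path_arcs_rtrancl[of u "xs @ [v]"] by (metis rtrancl_mono last_snoc subsetD)
      qed
      then have "(v, v) \<in> D\<^sup>+" using vu by (rule rtrancl_into_trancl2[rotated])
      then show False using forests_acyclic[OF D] by (simp add: acyclic_def)
    qed
    moreover have "path_arcs (v # u # p) \<subseteq> arcs_of (undirected D)"
      using p vu by (auto simp: arcs_of_undirected)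
    ultimately show "(v, u) \<in> in_tree (undirected D) r"
      using p unfolding in_tree_alt by (intro exI[of _ p]) simp
  qed
  have "(v, u) \<in> D" if vu: "(v, u) \<in> in_tree (undirected D) r" for v u
  proof -
    have "v \<in> V" "v \<noteq> r"
      using vu F forests_arcs[OF F] simple_graph_arcD[OF graph] by (auto simp: forests_def)
    then obtain w where "(v, w) \<in> D" using D unfolding forests_def by blast
    then show ?thesis using sub forests_functional[OF F] vu by blast
  qed
  then show ?thesis using sub by auto
qed

text \<open>Orienting towards \<open>r\<close> and forgetting directions are mutually
  inverse.\<close>

lemma sum_spanning_trees:
  assumes r: "r \<in> V"
  shows "(\<Sum>T\<in>spanning_trees V E. f (in_tree T r)) = (\<Sum>D\<in>forests V E {r}. f D)"
  by (rule sum.reindex_bij_witness[of _ undirected "\<lambda>T. in_tree T r"])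
     (use r in \<open>auto simp: undirected_in_tree in_tree_undirected in_tree_forest
        undirected_forest_spanning_tree\<close>)

end

section \<open>The Kirchhoff formula for the stationary distribution\<close>

definition tree_weight :: "'a set \<Rightarrow> 'a set set \<Rightarrow> ('a \<Rightarrow> 'a \<Rightarrow> real) \<Rightarrow> 'a \<Rightarrow> real" where
  "tree_weight V E k r = (\<Sum>D\<in>forests V E {r}. weight k D)"

text \<open>Since one arc leaves every vertex, reachability of \<open>x\<close> from everywhere
  encodes that the only directed cycle passes through \<open>x\<close>.\<close>

definition unicyclic :: "'a set \<Rightarrow> 'a set set \<Rightarrow> 'a \<Rightarrow> ('a \<times> 'a) set set" where
  "unicyclic V E x =
     {G. G \<subseteq> arcs_of E \<and> (\<forall>v\<in>V. (\<exists>!u. (v, u) \<in> G) \<and> (v, x) \<in> G\<^sup>*)}"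

text \<open>The stationarity equations for arbitrary real functions, so that they apply to
  unnormalized tree weights and to differences of solutions.\<close>

definition balanced :: "'a set \<Rightarrow> ('a \<Rightarrow> 'a \<Rightarrow> real) \<Rightarrow> ('a \<Rightarrow> real) \<Rightarrow> bool" where
  "balanced V k m \<longleftrightarrow> (\<forall>x\<in>V. (\<Sum>y\<in>V. k x y * m x - k y x * m y) = 0)"

lemma weight_insert:
  "finite D \<Longrightarrow> (a, b) \<notin> D \<Longrightarrow> weight k (insert (a, b) D) = k a b * weight k D"
  by (simp add: weight_def)

lemma weight_Un:
  "finite C \<Longrightarrow> finite D \<Longrightarrow> C \<inter> D = {} \<Longrightarrow> weight k (C \<union> D) = weight k C * weight k D"
  by (simp add: weight_def prod.union_disjoint)

text \<open>Up to its first visit to \<open>R\<close>, a walk uses no arc leaving \<open>R\<close>.\<close>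

lemma rtrancl_stop:
  assumes "(v, r) \<in> G\<^sup>*" "r \<in> R"
  shows "\<exists>u\<in>R. (v, u) \<in> {(a, b) \<in> G. a \<notin> R}\<^sup>*"
  using assms(1)
proof (induction rule: converse_rtrancl_induct)
  case base
  then show ?case using assms(2) by blast
next
  case (step v w)
  show ?case
  proof (cases "v \<in> R")
    case False
    then have "(v, w) \<in> {(a, b) \<in> G. a \<notin> R}" using step by simp
    then show ?thesis using step.IH by (meson converse_rtrancl_into_rtrancl)
  qed blast
qed

section \<open>Balance equations for the tree weights\<close>

context
  fixes V :: "'a set" and E :: "'a set set"
  assumes graph: "simple_graph V E"
begin

lemma finite_V: "finite V"
  using graph by (simp add: simple_graph_def)

text \<open>All vertices reach the root \<open>a\<close>, and through the new arc also
  \<open>b\<close>. The case \<open>x = a\<close> serves the arcs leaving \<open>x\<close>, the case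
  \<open>x = b\<close> those entering it.\<close>

lemma insert_arc_unicyclic:
  assumes D: "D \<in> forests V E {a}" and ab: "(a, b) \<in> arcs_of E" and x: "x = a \<or> x = b"
  shows "insert (a, b) D \<in> unicyclic V E x"
proof -
  let ?G = "insert (a, b) D"
  have "(v, a) \<in> ?G\<^sup>*" if "v \<in> V" for v
    using forests_reach[OF D that] rtrancl_mono[of D ?G] by blast
  then have "(v, x) \<in> ?G\<^sup>*" if "v \<in> V" for v
    using that x by (auto intro: rtrancl_into_rtrancl)
  moreover have "\<exists>!u. (v, u) \<in> ?G" if "v \<in> V" for v
    using D that by (cases "v = a") (auto simp: forests_def)
  ultimately show ?thesis
    using forests_arcs[OF D] ab by (auto simp: unicyclic_def)
qed

text \<open>Every vertex reaches \<open>a\<close> by way of \<open>x\<close>. A walk stopped at its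
  first visit to \<open>a\<close> does not use \<open>(a, b)\<close>, the only arc out of
  \<open>a\<close>.\<close>

lemma delete_arc_forest:
  assumes G: "G \<in> unicyclic V E x" and ab: "(a, b) \<in> G" and xa: "(x, a) \<in> G\<^sup>*"
  shows "G - {(a, b)} \<in> forests V E {a}"
proof -
  have a: "a \<in> V" using G ab simple_graph_arcD[OF graph] by (auto simp: unicyclic_def)
  have G': "{(c, d) \<in> G. c \<notin> {a}} = G - {(a, b)}"
    using G ab a unfolding unicyclic_def by blast
  have "(v, a) \<in> (G - {(a, b)})\<^sup>*" if "v \<in> V" for v
  proof -
    have "(v, a) \<in> G\<^sup>*"
      using G that xa by (auto simp: unicyclic_def intro: rtrancl_trans)
    from rtrancl_stop[OF this, of "{a}"] show ?thesis unfolding G' by simp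
  qed
  moreover have "(a, u) \<notin> G - {(a, b)}" for u
    using G' by blast
  moreover have "\<exists>!u. (v, u) \<in> G - {(a, b)}" if "v \<in> V" "v \<noteq> a" for v
    using G that by (simp add: unicyclic_def)
  moreover have "G - {(a, b)} \<subseteq> arcs_of E" using G by (auto simp: unicyclic_def)
  ultimately show ?thesis by (simp add: forests_def)
qed

text \<open>The inverse deletes the unique arc out of \<open>x\<close>; no arc of \<open>D\<close>
  leaves its root, so \<open>y\<close> and \<open>D\<close> can be read off.\<close>

lemma unicyclic_out_bij:
  assumes x: "x \<in> V"
  shows "bij_betw (\<lambda>(y, D). insert (x, y) D)
    ({y. (x, y) \<in> arcs_of E} \<times> forests V E {x}) (unicyclic V E x)"
proof (rule bij_betw_imageI)
  show "inj_on (\<lambda>(y, D). insert (x, y) D) ({y. (x, y) \<in> arcs_of E} \<times> forests V E {x})"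
  proof (rule inj_onI, clarify)
    fix y D y' D'
    assume D: "D \<in> forests V E {x}" "D' \<in> forests V E {x}"
      and eq: "insert (x, y) D = insert (x, y') D'"
    have "(x, u) \<notin> D" "(x, u) \<notin> D'" for u using D by (auto simp: forests_def)
    moreover from this have "y = y'" using eq by blast
    ultimately show "y = y' \<and> D = D'" using eq by (simp add: insert_ident)
  qed
  show "(\<lambda>(y, D). insert (x, y) D) ` ({y. (x, y) \<in> arcs_of E} \<times> forests V E {x}) =
      unicyclic V E x"
  proof (intro equalityI subsetI)
    fix G assume "G \<in> unicyclic V E x"
    moreover from this obtain y where "(x, y) \<in> G" "(x, y) \<in> arcs_of E"
      using x unfolding unicyclic_def by blast
    moreover from calculation have "G - {(x, y)} \<in> forests V E {x}"
      using delete_arc_forest by blast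
    ultimately show "G \<in> (\<lambda>(y, D). insert (x, y) D) `
        ({y. (x, y) \<in> arcs_of E} \<times> forests V E {x})"
      by (intro image_eqI[of _ _ "(y, G - {(x, y)})"]) auto
  qed (auto intro: insert_arc_unicyclic)
qed

text \<open>The inverse deletes the arc by which the cycle through \<open>x\<close> returns to
  \<open>x\<close>. Other arcs may enter \<open>x\<close> too, so injectivity needs an argument
  about cycles.\<close>

lemma unicyclic_in_bij:
  assumes x: "x \<in> V"
  shows "bij_betw (\<lambda>(y, D). insert (y, x) D)
    (SIGMA y:{y. (y, x) \<in> arcs_of E}. forests V E {y}) (unicyclic V E x)"
proof (rule bij_betw_imageI)
  \<comment> \<open>If \<open>y\<close> and \<open>y'\<close> differ, the walk from \<open>x\<close>
    to \<open>y\<close> in \<open>D\<close> avoids leaving \<open>y'\<close>, since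
    \<open>(y', x)\<close> would close a cycle in \<open>D\<close>. Hence it runs in
    \<open>D'\<close>, where \<open>(y, x)\<close> closes it to a cycle.\<close>
  have same: "y = y'"
    if D: "D \<in> forests V E {y}" "D' \<in> forests V E {y'}"
      and eq: "insert (y, x) D = insert (y', x) D'" for y y' D D'
  proof (rule ccontr)
    assume ne: "y \<noteq> y'"
    then have yx: "(y', x) \<in> D" "(y, x) \<in> D'" using eq by auto
    have "(x, z) \<in> D'\<^sup>*" if "(x, z) \<in> D\<^sup>*" for z
      using that
    proof induction
      case (step z w)
      have "z \<noteq> y'"
      proof
        assume "z = y'"
        then have "(x, x) \<in> D\<^sup>+" using step.hyps(1) yx(1) by (meson rtrancl_into_trancl1)
        then show False using forests_acyclic[OF graph D(1)] by (simp add: acyclic_def)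
      qed
      then have "(z, w) \<in> D'" using step.hyps(2) eq by auto
      then show ?case using step.IH by (rule rtrancl_into_rtrancl[rotated])
    qed simp
    then have "(x, x) \<in> D'\<^sup>+"
      using forests_reach[OF D(1) x] yx(2) by (meson rtrancl_into_trancl1)
    then show False using forests_acyclic[OF graph D(2)] by (simp add: acyclic_def)
  qed
  show "inj_on (\<lambda>(y, D). insert (y, x) D)
      (SIGMA y:{y. (y, x) \<in> arcs_of E}. forests V E {y})"
  proof (rule inj_onI, clarify)
    fix y D y' D'
    assume D: "D \<in> forests V E {y}" "D' \<in> forests V E {y'}"
      and eq: "insert (y, x) D = insert (y', x) D'"
    have "y = y'" by (rule same[OF D eq])
    moreover have "(y, x) \<notin> D" "(y', x) \<notin> D'" using D by (auto simp: forests_def)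
    ultimately show "y = y' \<and> D = D'" using eq by (simp add: insert_ident)
  qed
  show "(\<lambda>(y, D). insert (y, x) D) ` (SIGMA y:{y. (y, x) \<in> arcs_of E}. forests V E {y}) =
      unicyclic V E x"
  proof (intro equalityI subsetI)
    fix G assume G: "G \<in> unicyclic V E x"
    then obtain u where u: "(x, u) \<in> G"
      using x unfolding unicyclic_def by blast
    then have "u \<in> V" using G simple_graph_arcD(2)[OF graph] by (auto simp: unicyclic_def)
    then have "(x, x) \<in> G\<^sup>+"
      using G u by (auto simp: unicyclic_def intro: rtrancl_into_trancl2)
    then obtain y where y: "(x, y) \<in> G\<^sup>*" "(y, x) \<in> G" by (meson tranclD2)
    then have "(y, x) \<in> arcs_of E" using G by (auto simp: unicyclic_def)
    with delete_arc_forest[OF G y(2,1)] y(2)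
    show "G \<in> (\<lambda>(y, D). insert (y, x) D) `
        (SIGMA y:{y. (y, x) \<in> arcs_of E}. forests V E {y})"
      by (intro image_eqI[of _ _ "(y, G - {(y, x)})"]) auto
  qed (auto intro: insert_arc_unicyclic)
qed

context
  fixes k :: "'a \<Rightarrow> 'a \<Rightarrow> real"
  assumes rates: "jump_rates V E k"
begin

lemma rate_pos: "(a, b) \<in> arcs_of E \<Longrightarrow> k a b > 0"
  using rates simple_graph_arcD[OF graph, of a b]
  by (auto simp: jump_rates_def arcs_of_def split: if_splits)

lemma rate_zero: "a \<in> V \<Longrightarrow> b \<in> V \<Longrightarrow> (a, b) \<notin> arcs_of E \<Longrightarrow> k a b = 0"
  using rates by (auto simp: jump_rates_def arcs_of_def split: if_splits)

lemma rate_nonneg: "a \<in> V \<Longrightarrow> b \<in> V \<Longrightarrow> k a b \<ge> 0"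
  using rate_pos rate_zero by (cases "(a, b) \<in> arcs_of E") (auto intro: less_imp_le)

lemma weight_pos: "D \<subseteq> arcs_of E \<Longrightarrow> weight k D > 0"
  unfolding weight_def by (rule prod_pos) (use rate_pos in auto)

text \<open>Multiplying by \<open>k x y\<close> inserts the arc \<open>(x, y)\<close> into the
  weight, and vertices not adjacent to \<open>x\<close> contribute 0.\<close>

lemma tree_weight_out:
  assumes x: "x \<in> V"
  shows "(\<Sum>y\<in>V. k x y * tree_weight V E k x) = (\<Sum>G\<in>unicyclic V E x. weight k G)"
proof -
  let ?N = "{y. (x, y) \<in> arcs_of E}"
  have N: "?N \<subseteq> V" using simple_graph_arcD[OF graph] by auto
  have "(\<Sum>y\<in>V. k x y * tree_weight V E k x) = (\<Sum>y\<in>?N. k x y * tree_weight V E k x)"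
    by (rule sum.mono_neutral_right) (use N x rate_zero finite_V in auto)
  also have "\<dots> = (\<Sum>y\<in>?N. \<Sum>D\<in>forests V E {x}. weight k (insert (x, y) D))"
    unfolding tree_weight_def sum_distrib_left
  proof (intro sum.cong refl)
    fix y D assume D: "D \<in> forests V E {x}"
    then have "(x, y) \<notin> D" by (auto simp: forests_def)
    then show "k x y * weight k D = weight k (insert (x, y) D)"
      using forests_finite_arcs[OF graph D] by (simp add: weight_insert)
  qed
  also have "\<dots> = (\<Sum>(y, D)\<in>?N \<times> forests V E {x}. weight k (insert (x, y) D))"
    by (rule sum.cartesian_product)
  also have "\<dots> = (\<Sum>G\<in>unicyclic V E x. weight k G)"
    using sum.reindex_bij_betw[OF unicyclic_out_bij[OF x], of "weight k"]
    by (simp add: case_prod_unfold)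
  finally show ?thesis .
qed

lemma tree_weight_in:
  assumes x: "x \<in> V"
  shows "(\<Sum>y\<in>V. k y x * tree_weight V E k y) = (\<Sum>G\<in>unicyclic V E x. weight k G)"
proof -
  let ?N = "{y. (y, x) \<in> arcs_of E}"
  have N: "?N \<subseteq> V" using simple_graph_arcD[OF graph] by auto
  have "(\<Sum>y\<in>V. k y x * tree_weight V E k y) = (\<Sum>y\<in>?N. k y x * tree_weight V E k y)"
    by (rule sum.mono_neutral_right) (use N x rate_zero finite_V in auto)
  also have "\<dots> = (\<Sum>y\<in>?N. \<Sum>D\<in>forests V E {y}. weight k (insert (y, x) D))"
    unfolding tree_weight_def sum_distrib_left
  proof (intro sum.cong refl)
    fix y D assume D: "D \<in> forests V E {y}"
    then have "(y, x) \<notin> D" by (auto simp: forests_def)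
    then show "k y x * weight k D = weight k (insert (y, x) D)"
      using forests_finite_arcs[OF graph D] by (simp add: weight_insert)
  qed
  also have "\<dots> = (\<Sum>(y, D)\<in>(SIGMA y:?N. forests V E {y}). weight k (insert (y, x) D))"
    by (rule sum.Sigma) (use finite_subset[OF N finite_V] finite_forests[OF graph] in auto)
  also have "\<dots> = (\<Sum>G\<in>unicyclic V E x. weight k G)"
    using sum.reindex_bij_betw[OF unicyclic_in_bij[OF x], of "weight k"]
    by (simp add: case_prod_unfold)
  finally show ?thesis .
qed

text \<open>The Markov chain tree theorem: outflow and inflow at \<open>x\<close> both equal the
  total weight of \<open>unicyclic V E x\<close>.\<close>

lemma balanced_tree_weight: "balanced V k (tree_weight V E k)"
  by (simp add: balanced_def sum_subtractf tree_weight_out tree_weight_in)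

section \<open>Uniqueness and existence of the stationary distribution\<close>

context
  assumes connected: "connected_graph V E"
begin

lemma tree_weight_pos: "r \<in> V \<Longrightarrow> tree_weight V E k r > 0"
  unfolding tree_weight_def
  using forests_nonempty[OF graph connected] finite_forests[OF graph] weight_pos forests_arcs
  by (intro sum_pos) blast+

text \<open>Where \<open>m\<close> vanishes, balance makes the inflow, a sum of nonnegative terms,
  vanish too. So \<open>m\<close> is zero at all neighbours, and connectedness spreads this to
  \<open>V\<close>.\<close>

lemma balanced_zero:
  assumes "balanced V k m" and nonneg: "\<And>v. v \<in> V \<Longrightarrow> m v \<ge> 0"
    and a: "a \<in> V" "m a = 0" and v: "v \<in> V"
  shows "m v = 0"
proof -
  have "(v, a) \<in> (arcs_of E)\<^sup>*"
    using connected v a by (simp add: connected_graph_def)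
  then show ?thesis
  proof (induction rule: converse_rtrancl_induct)
    case (step v u)
    have uv: "u \<in> V" "v \<in> V" using simple_graph_arcD[OF graph] step.hyps(1) by blast+
    have "(\<Sum>y\<in>V. k u y * m u - k y u * m y) = 0"
      using assms(1) uv by (simp add: balanced_def)
    then have "(\<Sum>y\<in>V. k y u * m y) = 0" using step.IH by (simp add: sum_negf)
    then have "k v u * m v = 0"
      using uv nonneg rate_nonneg finite_V by (subst (asm) sum_nonneg_eq_0_iff) auto
    then show ?case using rate_pos[OF step.hyps(1)] by simp
  qed (use a in simp)
qed

lemma balanced_unique:
  assumes m: "balanced V k m" and p: "balanced V k p" "\<And>v. v \<in> V \<Longrightarrow> p v > 0"
  obtains c where "\<And>v. v \<in> V \<Longrightarrow> m v = c * p v"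
proof
  \<comment> \<open>With the maximal ratio as \<open>c\<close>, the function
    \<open>c * p v - m v\<close> is balanced, nonnegative and zero where the maximum is attained, so
    \<open>balanced_zero\<close> applies.\<close>
  define c where "c = Max ((\<lambda>v. m v / p v) ` V)"
  have ne: "V \<noteq> {}" using graph by (simp add: simple_graph_def)
  have "c \<in> (\<lambda>v. m v / p v) ` V"
    unfolding c_def using ne finite_V by (intro Max_in) auto
  then obtain a where a: "a \<in> V" "c = m a / p a" by blast
  have le: "m v / p v \<le> c" if "v \<in> V" for v
    unfolding c_def using that finite_V by (intro Max_ge) auto
  have "balanced V k (\<lambda>v. c * p v - m v)"
    unfolding balanced_def
  proof
    fix x assume x: "x \<in> V"
    have "(\<Sum>y\<in>V. k x y * (c * p x - m x) - k y x * (c * p y - m y)) =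
        c * (\<Sum>y\<in>V. k x y * p x - k y x * p y) - (\<Sum>y\<in>V. k x y * m x - k y x * m y)"
      unfolding sum_distrib_left sum_subtractf[symmetric]
      by (intro sum.cong refl) (simp add: algebra_simps)
    then show "(\<Sum>y\<in>V. k x y * (c * p x - m x) - k y x * (c * p y - m y)) = 0"
      using x m p(1) by (simp add: balanced_def)
  qed
  moreover have "c * p v - m v \<ge> 0" if "v \<in> V" for v
    using le[OF that] p(2)[OF that] by (simp add: pos_divide_le_eq)
  moreover have "c * p a - m a = 0" using a p(2)[of a] by simp
  ultimately have "c * p v - m v = 0" if "v \<in> V" for v
    using balanced_zero a(1) that by blast
  then show "m v = c * p v" if "v \<in> V" for v using that by fastforce
qed

lemma normalization_eq: "normalization V E k = (\<Sum>r\<in>V. tree_weight V E k r)"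
  by (simp add: normalization_def tree_weight_def sum_spanning_trees[OF graph])

lemma normalization_pos: "normalization V E k > 0"
  unfolding normalization_eq
  using graph tree_weight_pos finite_V by (intro sum_pos) (auto simp: simple_graph_def)

text \<open>By \<open>balanced_unique\<close> the distribution is a multiple of the tree weights,
  and total mass 1 fixes the factor.\<close>

lemma is_stationary_unique:
  assumes "is_stationary V k \<rho>" "x \<in> V"
  shows "pmf \<rho> x = tree_weight V E k x / normalization V E k"
proof -
  have \<rho>: "set_pmf \<rho> \<subseteq> V" "balanced V k (pmf \<rho>)"
    using assms by (auto simp: is_stationary_def balanced_def)
  obtain c where c: "\<And>v. v \<in> V \<Longrightarrow> pmf \<rho> v = c * tree_weight V E k v"
    using balanced_unique[OF \<rho>(2) balanced_tree_weight tree_weight_pos] by blast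
  have "1 = (\<Sum>v\<in>V. pmf \<rho> v)" using \<rho>(1) finite_V by (simp add: sum_pmf_eq_1)
  also have "\<dots> = c * normalization V E k"
    by (simp add: c normalization_eq sum_distrib_left)
  finally show ?thesis
    using c[OF assms(2)] normalization_pos by (simp add: field_simps)
qed

lemma is_stationary_exists: "\<exists>\<rho>. is_stationary V k \<rho>"
proof -
  define W where "W = normalization V E k"
  \<comment> \<open>The value 0 outside \<open>V\<close> makes \<open>f\<close> a probability mass
    function on the whole type, as \<open>embed_pmf\<close> requires.\<close>
  define f where "f x = (if x \<in> V then tree_weight V E k x / W else 0)" for x
  have W: "W > 0" using normalization_pos by (simp add: W_def)
  have nonneg: "f x \<ge> 0" for x
    using tree_weight_pos[of x] W by (auto simp: f_def intro: less_imp_le)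
  have "(\<integral>\<^sup>+x. ennreal (f x) \<partial>count_space UNIV) = (\<Sum>x\<in>V. ennreal (f x))"
    by (rule nn_integral_count_space'[OF finite_V]) (auto simp: f_def)
  also have "\<dots> = ennreal (\<Sum>x\<in>V. f x)"
    using nonneg by simp
  also have "(\<Sum>x\<in>V. f x) = 1"
    using W by (simp add: f_def W_def normalization_eq flip: sum_divide_distrib)
  finally have f: "pmf (embed_pmf f) x = f x" for x
    by (intro pmf_embed_pmf nonneg) simp
  have "is_stationary V k (embed_pmf f)"
    unfolding is_stationary_def
  proof (intro conjI ballI)
    show "set_pmf (embed_pmf f) \<subseteq> V"
      by (auto simp: set_pmf_eq f) (auto simp: f_def split: if_splits)
    fix x assume x: "x \<in> V"
    have "(\<Sum>y\<in>V. k x y * f x - k y x * f y) =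
        (\<Sum>y\<in>V. k x y * tree_weight V E k x - k y x * tree_weight V E k y) / W"
      unfolding sum_divide_distrib using x
      by (intro sum.cong refl) (simp add: f_def diff_divide_distrib)
    also have "\<dots> = 0" using balanced_tree_weight x by (simp add: balanced_def)
    finally show "(\<Sum>y\<in>V. k x y * pmf (embed_pmf f) x - k y x * pmf (embed_pmf f) y) = 0"
      by (simp add: f)
  qed
  then show ?thesis by blast
qed

lemma stationary_distribution_eq:
  assumes "x \<in> V"
  shows "pmf (stationary_distribution V k) x = tree_weight V E k x / normalization V E k"
proof -
  have "\<rho> = \<rho>'" if "is_stationary V k \<rho>" "is_stationary V k \<rho>'" for \<rho> \<rho>'
  proof (rule pmf_eqI)
    fix v
    show "pmf \<rho> v = pmf \<rho>' v"
    proof (cases "v \<in> V")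
      case False
      then have "v \<notin> set_pmf \<rho>" "v \<notin> set_pmf \<rho>'" using that by (auto simp: is_stationary_def)
      then show ?thesis by (simp add: set_pmf_iff)
    qed (use that is_stationary_unique in simp)
  qed
  then have "is_stationary V k (stationary_distribution V k)"
    unfolding stationary_distribution_def using is_stationary_exists by (metis theI)
  then show ?thesis using assms by (rule is_stationary_unique)
qed

end

end

end

section \<open>Loops through an edge\<close>

text \<open>The paths run from \<open>y\<close> to \<open>x\<close>, so that closing one by
  \<open>(x, y)\<close> gives a loop oriented from \<open>x\<close> to \<open>y\<close>.\<close>

definition paths_between :: "'a set set \<Rightarrow> 'a \<Rightarrow> 'a \<Rightarrow> 'a list set" where
  "paths_between E y x =
     {p. p \<noteq> [] \<and> distinct p \<and> hd p = y \<and> last p = x \<and> path_arcs p \<subseteq> arcs_of E}"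

lemma cycle_with_arc_path:
  assumes "D \<in> directed_cycles E" "(x, y) \<in> D"
  obtains p where "p \<in> paths_between E y x" "length p \<ge> 3" "D = cycle_arcs p"
proof -
  obtain vs where vs: "D = cycle_arcs vs" "distinct vs" "length vs \<ge> 3" "cycle_arcs vs \<subseteq> arcs_of E"
    using assms(1) by (auto simp: directed_cycles_def)
  obtain p where p: "distinct p" "length p = length vs" "cycle_arcs p = cycle_arcs vs" "p \<noteq> []"
      "hd p = y" "last p = x"
    using cycle_rotate_to[of x y vs] assms(2) vs by metis
  then have "p \<in> paths_between E y x"
    using vs by (auto simp: paths_between_def cycle_arcs_eq)
  then show ?thesis using that p vs by metis
qed

lemma directed_cycles_converse:
  assumes "D \<in> directed_cycles E"
  shows "D\<inverse> \<in> directed_cycles E"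
proof -
  obtain vs where vs: "D = cycle_arcs vs" "distinct vs" "length vs \<ge> 3" "D \<subseteq> arcs_of E"
    using assms by (auto simp: directed_cycles_def)
  have "D\<inverse> = cycle_arcs (rev vs)" using vs by (subst cycle_arcs_rev) auto
  moreover have "D\<inverse> \<subseteq> arcs_of E"
    using vs sym_arcs_of[of E] unfolding sym_conv_converse_eq by blast
  ultimately show ?thesis using vs unfolding directed_cycles_def
    by (intro CollectI exI[of _ "rev vs"]) simp
qed

text \<open>Fixed ends remove both ambiguities of an undirected cycle, the starting vertex and the
  direction.\<close>

lemma paths_between_undirected_inj:
  "inj_on (\<lambda>p. undirected (cycle_arcs p)) (paths_between E y x)"
  by (rule inj_onI) (auto simp: paths_between_def intro: undirected_cycle_inj)

lemma short_path_between:
  assumes "p \<in> paths_between E y x" "x \<noteq> y" "\<not> length p \<ge> 3"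
  shows "p = [y, x]"
proof -
  obtain a q where "p = a # q" using assms by (cases p) (auto simp: paths_between_def)
  moreover obtain b r where "q = b # r"
    using assms calculation by (cases q) (auto simp: paths_between_def)
  ultimately show ?thesis using assms by (cases r) (auto simp: paths_between_def)
qed

lemma paths_between_cycle_arcs:
  "p \<in> paths_between E y x \<Longrightarrow> cycle_arcs p = insert (x, y) (path_arcs p)"
  by (auto simp: paths_between_def cycle_arcs_eq)

section \<open>Loops as simple paths closed by the edge\<close>

context
  fixes V :: "'a set" and E :: "'a set set" and x y :: 'a
  assumes graph: "simple_graph V E" and edge: "{x, y} \<in> E"
begin

lemma edge_arc: "(x, y) \<in> arcs_of E" "(y, x) \<in> arcs_of E"
  using edge by (auto simp: arcs_of_def insert_commute)

lemma edge_ends: "x \<noteq> y" "x \<in> V" "y \<in> V"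
  using simple_graph_arcD[OF graph edge_arc(1)] by auto

lemma trivial_path: "[y, x] \<in> paths_between E y x"
  using edge_arc edge_ends by (simp add: paths_between_def)

lemma trivial_loop: "undirected (cycle_arcs [y, x]) = {{x, y}}"
  by (simp add: cycle_arcs_eq insert_commute)

lemma long_path_cycle:
  assumes "p \<in> paths_between E y x" "length p \<ge> 3"
  shows "cycle_arcs p \<in> directed_cycles E"
proof -
  have "cycle_arcs p \<subseteq> arcs_of E" "distinct p"
    using assms(1) paths_between_cycle_arcs[OF assms(1)] edge_arc by (auto simp: paths_between_def)
  then show ?thesis unfolding directed_cycles_def using assms(2) by blast
qed

text \<open>Paths with at least three vertices give the simple cycles, and \<open>[y, x]\<close>
  gives the trivial loop. A cycle that traverses the edge from \<open>y\<close> to \<open>x\<close>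
  is reversed before it is cut open.\<close>

lemma loops_eq_paths:
  "bij_betw (\<lambda>p. undirected (cycle_arcs p)) (paths_between E y x) (loops_containing E x y)"
proof (rule bij_betw_imageI[OF paths_between_undirected_inj], intro equalityI subsetI)
  fix L assume "L \<in> (\<lambda>p. undirected (cycle_arcs p)) ` paths_between E y x"
  then obtain p where p: "p \<in> paths_between E y x" "L = undirected (cycle_arcs p)" by blast
  show "L \<in> loops_containing E x y"
  proof (cases "length p \<ge> 3")
    case True
    then have "L \<in> simple_cycles E" using long_path_cycle p by (auto simp: simple_cycles_def)
    moreover have "{x, y} \<in> L" using p paths_between_cycle_arcs[OF p(1)] by simp
    ultimately show ?thesis by (simp add: loops_containing_def)
  next
    case False
    then have "p = [y, x]" by (rule short_path_between[OF p(1) edge_ends(1)])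
    then show ?thesis using p(2) trivial_loop by (simp add: loops_containing_def)
  qed
next
  fix L assume "L \<in> loops_containing E x y"
  then consider "L = {{x, y}}" | "L \<in> simple_cycles E" "{x, y} \<in> L"
    by (auto simp: loops_containing_def)
  then show "L \<in> (\<lambda>p. undirected (cycle_arcs p)) ` paths_between E y x"
  proof cases
    case 1
    then show ?thesis using trivial_path trivial_loop by (metis image_eqI)
  next
    case 2
    then obtain D where D: "D \<in> directed_cycles E" "L = undirected D"
      by (auto simp: simple_cycles_def)
    have "\<exists>D'\<in>directed_cycles E. L = undirected D' \<and> (x, y) \<in> D'"
    proof (cases "(x, y) \<in> D")
      case False
      then have "(x, y) \<in> D\<inverse>" using 2(2) D(2) by (simp add: in_undirected_iff)
      then show ?thesis
        using D directed_cycles_converse[OF D(1)] by (intro bexI[of _ "D\<inverse>"]) (simp_all add: undirected_converse)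
    qed (use D in blast)
    then obtain D' where D': "D' \<in> directed_cycles E" "L = undirected D'" "(x, y) \<in> D'" by blast
    obtain p where "p \<in> paths_between E y x" "D' = cycle_arcs p"
      using cycle_with_arc_path[OF D'(1,3)] by blast
    then show ?thesis using D'(2) by blast
  qed
qed

text \<open>Any other candidate orientation is also a closed path from \<open>y\<close> to
  \<open>x\<close> with the same edge set, so injectivity identifies the two.\<close>

lemma orient_cycle_path:
  assumes p: "p \<in> paths_between E y x" "length p \<ge> 3"
  shows "orient_cycle (undirected (cycle_arcs p)) x y = cycle_arcs p"
  unfolding orient_cycle_def
proof (rule the_equality)
  let ?L = "undirected (cycle_arcs p)"
  have xy: "(x, y) \<in> cycle_arcs p" using paths_between_cycle_arcs[OF p(1)] by simp
  have "cycle_arcs p \<subseteq> arcs_of ?L" by (simp flip: undirected_subset_iff)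
  then show "cycle_arcs p \<in> directed_cycles ?L \<and> undirected (cycle_arcs p) = ?L \<and>
      (x, y) \<in> cycle_arcs p"
    using p xy by (auto simp: directed_cycles_def paths_between_def)
  fix D assume D: "D \<in> directed_cycles ?L \<and> undirected D = ?L \<and> (x, y) \<in> D"
  then obtain q where q: "q \<in> paths_between ?L y x" "D = cycle_arcs q"
    using cycle_with_arc_path by metis
  have "p \<in> paths_between ?L y x"
    using p(1) \<open>cycle_arcs p \<subseteq> arcs_of ?L\<close> by (auto simp: paths_between_def cycle_arcs_eq)
  then show "D = cycle_arcs p"
    using inj_onD[OF paths_between_undirected_inj] q D by metis
qed

text \<open>Removes the case distinction for the trivial loop: for \<open>p = [y, x]\<close> the two
  opposite arcs have weight \<open>k x y * k y x\<close>, and by injectivity no longer path has the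
  edge set \<open>{{x, y}}\<close>.\<close>

lemma loop_weight_path:
  assumes p: "p \<in> paths_between E y x"
  shows "loop_weight k (undirected (cycle_arcs p)) x y = weight k (cycle_arcs p)"
proof (cases "length p \<ge> 3")
  case True
  then have "p \<noteq> [y, x]" by auto
  then have "undirected (cycle_arcs p) \<noteq> {{x, y}}"
    using inj_onD[OF paths_between_undirected_inj _ p trivial_path] trivial_loop by metis
  then show ?thesis using orient_cycle_path[OF p True] by (simp add: loop_weight_def)
next
  case False
  then have "p = [y, x]" by (rule short_path_between[OF p edge_ends(1)])
  then show ?thesis
    using trivial_loop edge_ends(1) by (simp add: loop_weight_def cycle_arcs_eq weight_def)
qed

section \<open>Splitting a rooted forest into a path and hairs\<close>

lemma finite_paths_between: "finite (paths_between E y x)"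
proof (rule finite_subset)
  show "paths_between E y x \<subseteq> {p. set p \<subseteq> V \<and> distinct p}"
  proof (clarsimp simp: paths_between_def)
    fix p v assume p: "p \<noteq> []" "distinct p" "x = last p" "path_arcs p \<subseteq> arcs_of E" "v \<in> set p"
    show "v \<in> V"
    proof (cases "v = last p")
      case False
      then obtain w where "(v, w) \<in> path_arcs p" using path_arcs_step p by metis
      then show ?thesis using p simple_graph_arcD[OF graph] by blast
    qed (use edge_ends p in simp)
  qed
  show "finite {p. set p \<subseteq> V \<and> distinct p}"
    by (rule finite_subset_distinct[OF finite_V[OF graph]])
qed

text \<open>Path arcs start on \<open>p\<close>, while the arcs of \<open>H\<close> start outside
  it.\<close>

lemma path_arcs_forest_disjoint:
  assumes "H \<in> forests V E (set p)"
  shows "path_arcs p \<inter> H = {}"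
proof -
  have "fst a \<in> set p" if "a \<in> path_arcs p" for a
    using that path_arcs_subset[of p] by auto
  moreover have "fst a \<notin> set p" if "a \<in> H" for a
    using that assms by (cases a) (auto simp: forests_def)
  ultimately show ?thesis by blast
qed

text \<open>Following the arcs of a forest from \<open>y\<close> to the root \<open>x\<close> yields
  \<open>p\<close>; the arcs that start off \<open>p\<close> form \<open>H\<close>, and by
  \<open>rtrancl_stop\<close> they lead to \<open>p\<close>.\<close>

lemma forests_paths_bij:
  "bij_betw (\<lambda>(p, H). path_arcs p \<union> H)
     (SIGMA p:paths_between E y x. forests V E (set p)) (forests V E {x})"
proof (rule bij_betw_imageI)
  have into: "path_arcs p \<union> H \<in> forests V E {x}"
    if p: "p \<in> paths_between E y x" and H: "H \<in> forests V E (set p)" for p H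
  proof -
    let ?D = "path_arcs p \<union> H"
    have p': "p \<noteq> []" "distinct p" "last p = x" "path_arcs p \<subseteq> arcs_of E"
      using p by (auto simp: paths_between_def)
    have on: "(v, x) \<in> ?D\<^sup>*" if "v \<in> set p" for v
      using path_arcs_rtrancl[OF that] rtrancl_mono[of "path_arcs p" ?D] p' by auto
    have reach: "(v, x) \<in> ?D\<^sup>*" if v: "v \<in> V" for v
    proof (cases "v \<in> set p")
      case False
      then obtain u where "u \<in> set p" "(v, u) \<in> H\<^sup>*"
        using H v unfolding forests_def by blast
      then show ?thesis
        using on rtrancl_mono[of H ?D] by (meson Un_upper2 rtrancl_trans subsetD)
    qed (rule on)
    have out: "\<exists>!u. (v, u) \<in> ?D" if v: "v \<in> V" "v \<noteq> x" for v
    proof (cases "v \<in> set p")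
      case True
      then obtain u where "(v, u) \<in> path_arcs p" using path_arcs_step v p' by metis
      then show ?thesis
        using H True path_arcs_functional[OF p'(2)] by (intro ex1I[of _ u]) (auto simp: forests_def)
    next
      case False
      then have "\<exists>!u. (v, u) \<in> H" using H v by (simp add: forests_def)
      moreover have "(v, u) \<notin> path_arcs p" for u using False path_arcs_subset[of p] by auto
      ultimately show ?thesis by simp
    qed
    have "(x, u) \<notin> ?D" for u
      using path_arcs_source[OF p'(1,2), of x u] p' H last_in_set[OF p'(1)]
      by (auto simp: forests_def)
    then show ?thesis
      using reach out p'(4) forests_arcs[OF H] by (simp add: forests_def)
  qed
  show "inj_on (\<lambda>(p, H). path_arcs p \<union> H) (SIGMA p:paths_between E y x. forests V E (set p))"
  proof (rule inj_onI, clarify)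
    fix p H q K
    assume p: "p \<in> paths_between E y x" "H \<in> forests V E (set p)"
      and q: "q \<in> paths_between E y x" "K \<in> forests V E (set q)"
      and eq: "path_arcs p \<union> H = path_arcs q \<union> K"
    have "p = q"
    \<comment> \<open>Both paths lie in the same forest rooted at \<open>x\<close>, which is
      functional, and have the same ends.\<close>
    proof (rule distinct_path_unique[of "path_arcs p \<union> H"])
      show "b = c" if "(a, b) \<in> path_arcs p \<union> H" "(a, c) \<in> path_arcs p \<union> H" for a b c
        using forests_functional[OF graph into[OF p] that] .
      show "path_arcs q \<subseteq> path_arcs p \<union> H" unfolding eq by blast
    qed (use p(1) q(1) in \<open>auto simp: paths_between_def\<close>)
    moreover have "path_arcs p \<inter> H = {}" "path_arcs q \<inter> K = {}"
      using path_arcs_forest_disjoint p(2) q(2) by blast+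
    ultimately show "p = q \<and> H = K" using eq by blast
  qed
  show "(\<lambda>(p, H). path_arcs p \<union> H) ` (SIGMA p:paths_between E y x. forests V E (set p)) =
      forests V E {x}"
  proof (intro equalityI subsetI)
    fix D assume D: "D \<in> forests V E {x}"
    obtain q where q: "distinct (y # q)" "path_arcs (y # q) \<subseteq> D" "last (y # q) = x"
      using rtrancl_imp_path[OF forests_reach[OF D edge_ends(3)]] by metis
    define p where "p = y # q"
    have p: "p \<in> paths_between E y x"
      using q forests_arcs[OF D] by (auto simp: p_def paths_between_def)
    have p': "x \<in> set p" "last p = x" "path_arcs p \<subseteq> D"
      using q last_in_set[of p] by (auto simp: p_def)
    define H where "H = {(a, b) \<in> D. a \<notin> set p}"
    have "D = path_arcs p \<union> H"
    proof
      show "D \<subseteq> path_arcs p \<union> H"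
      proof (rule subrelI)
        fix a b assume ab: "(a, b) \<in> D"
        show "(a, b) \<in> path_arcs p \<union> H"
        proof (cases "a \<in> set p")
          case True
          \<comment> \<open>No arc leaves the root, so \<open>a\<close> is not the last vertex of
            \<open>p\<close>; its path arc is then its only arc in \<open>D\<close>.\<close>
          have "a \<noteq> x" using ab D by (auto simp: forests_def)
          then obtain c where "(a, c) \<in> path_arcs p" using path_arcs_step True p' by metis
          then have "(a, c) \<in> D" using p' by blast
          then have "c = b" using ab by (rule forests_functional[OF graph D])
          then show ?thesis using \<open>(a, c) \<in> path_arcs p\<close> by simp
        qed (use ab in \<open>simp add: H_def\<close>)
      qed
      show "path_arcs p \<union> H \<subseteq> D" using p' by (auto simp: H_def)
    qed
    moreover have "H \<in> forests V E (set p)"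
    proof -
      have "\<exists>!u. (v, u) \<in> H" if "v \<in> V - set p" for v
      proof -
        have "\<exists>!u. (v, u) \<in> D" using D that p'(1) by (auto simp: forests_def)
        then show ?thesis using that by (simp add: H_def)
      qed
      moreover have "\<exists>u\<in>set p. (v, u) \<in> H\<^sup>*" if "v \<in> V - set p" for v
        unfolding H_def using rtrancl_stop[OF forests_reach[OF D] p'(1)] that by blast
      ultimately show ?thesis using forests_arcs[OF D] by (auto simp: forests_def H_def)
    qed
    ultimately show "D \<in> (\<lambda>(p, H). path_arcs p \<union> H) `
        (SIGMA p:paths_between E y x. forests V E (set p))"
      using p by (intro image_eqI[of _ _ "(p, H)"]) auto
  qed (use into in auto)
qed

text \<open>A loop with hairs is a forest rooted at \<open>x\<close> together with the arc
  \<open>(x, y)\<close>; this arc contributes the constant factor \<open>k x y\<close>.\<close>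

lemma sum_loops_hairs:
  "(\<Sum>L\<in>loops_containing E x y. \<Sum>H\<in>hairs V E L. weight k H * loop_weight k L x y) =
     tree_weight V E k x * k x y"
proof -
  let ?P = "paths_between E y x"
  have ne: "p \<noteq> []" if "p \<in> ?P" for p using that by (simp add: paths_between_def)
  have w: "weight k H * weight k (cycle_arcs p) = weight k (path_arcs p \<union> H) * k x y"
    if p: "p \<in> ?P" and H: "H \<in> forests V E (set p)" for p H
  proof -
    have fin: "finite (path_arcs p)" by (simp add: path_arcs_def)
    have "(x, y) \<notin> path_arcs p" using p path_arcs_source[of p x y] by (auto simp: paths_between_def)
    then have "weight k (cycle_arcs p) = k x y * weight k (path_arcs p)"
      using fin by (simp add: paths_between_cycle_arcs[OF p] weight_insert)
    moreover have "path_arcs p \<inter> H = {}"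
      by (rule path_arcs_forest_disjoint[OF H])
    ultimately show ?thesis
      using fin forests_finite_arcs[OF graph H] by (simp add: weight_Un)
  qed
  have "(\<Sum>L\<in>loops_containing E x y. \<Sum>H\<in>hairs V E L. weight k H * loop_weight k L x y) =
      (\<Sum>p\<in>?P. \<Sum>H\<in>hairs V E (undirected (cycle_arcs p)).
         weight k H * loop_weight k (undirected (cycle_arcs p)) x y)"
    using sum.reindex_bij_betw[OF loops_eq_paths] by (rule sym)
  also have "\<dots> = (\<Sum>p\<in>?P. \<Sum>H\<in>forests V E (set p). weight k (path_arcs p \<union> H) * k x y)"
    by (intro sum.cong)
       (simp_all add: hairs_eq_forests Union_undirected_cycle ne loop_weight_path w)
  also have "\<dots> = (\<Sum>(p, H)\<in>(SIGMA p:?P. forests V E (set p)). weight k (path_arcs p \<union> H) * k x y)"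
    using finite_paths_between finite_forests[OF graph] by (intro sum.Sigma) auto
  also have "\<dots> = (\<Sum>D\<in>forests V E {x}. weight k D * k x y)"
    using sum.reindex_bij_betw[OF forests_paths_bij, of "\<lambda>D. weight k D * k x y"]
    by (simp add: case_prod_unfold)
  finally show ?thesis by (simp add: tree_weight_def sum_distrib_right)
qed

end

theorem mainTheorem4:
  fixes V :: "'a set" and E :: "'a set set" and k :: "'a \<Rightarrow> 'a \<Rightarrow> real" and x y :: 'a
  assumes "simple_graph V E"
    and "connected_graph V E"
    and "jump_rates V E k"
    and "{x, y} \<in> E"
  shows "traffic V k x y =
    1 / normalization V E k *
      (\<Sum>L\<in>loops_containing E x y. \<Sum>H\<in>hairs V E L.
         weight k H * (loop_weight k L x y + loop_weight k L y x))"
proof -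
  have yx: "{y, x} \<in> E" using assms(4) by (simp add: insert_commute)
  have V: "x \<in> V" "y \<in> V" using edge_ends[OF assms(1,4)] by auto
  \<comment> \<open>The orientation from \<open>y\<close> to \<open>x\<close> is covered by
    \<open>sum_loops_hairs\<close> with the ends exchanged, over the same set of loops.\<close>
  have "loops_containing E x y = loops_containing E y x"
    by (simp add: loops_containing_def insert_commute)
  then have "(\<Sum>L\<in>loops_containing E x y. \<Sum>H\<in>hairs V E L.
         weight k H * (loop_weight k L x y + loop_weight k L y x)) =
      tree_weight V E k x * k x y + tree_weight V E k y * k y x"
    using sum_loops_hairs[OF assms(1,4), of k] sum_loops_hairs[OF assms(1) yx, of k]
    by (simp add: distrib_left sum.distrib)
  then show ?thesis
    using V by (simp add: traffic_def add_divide_distrib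
        stationary_distribution_eq[OF assms(1,3,2)])
qed

end
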